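(* Let $p$ be a prime and $r\geq 1$ an integer. Let $A=\sum_{i=0}^{r}a_ip^i$ and $B=\sum_{i=0}^{r}b_ip^i$ with $a_i,b_i\in\{0,1,\ldots,p-1\}$, and write $A+B=\sum_{i=0}^{r+1}c_ip^i$ with $c_i\in\{0,1,\ldots,p-1\}$. Put $a_{r+1}=b_{r+1}=0$. Then $c_0\equiv a_0+b_0 \pmod p$, and for every $1\leq t\leq r+1$, $$c_t\equiv a_t+b_t+\sum_{i=0}^{t-1}\left(\sum_{k=1}^{p-1}\binom{a_i}{k}\binom{b_i}{p-k}\right)\prod_{j=i+1}^{t-1}\binom{a_j+b_j}{p-1}\pmod p.$$
   Context: Binomial coefficients $\binom{n}{k}$ are the usual ones for non-negative integers $n,k$ (equal to $0$ when $k>n$). An empty product equals $1$. *)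

theory Defs
  imports "HOL-Number_Theory.Number_Theory"
begin

end

theory Submission
  imports Defs
begin

text \<open>Let \<open>e t\<close> be the carry into position \<open>t\<close>, so that \<open>c t\<close> is the residue of
  \<open>a t + b t + e t\<close>. By Vandermonde's identity the inner sum over \<open>k\<close> is \<open>(a + b) choose p\<close>,
  which modulo \<open>p\<close> detects \<open>a + b \<ge> p\<close> (a carry is generated), while
  \<open>(a + b) choose (p - 1)\<close> detects \<open>a + b = p - 1\<close> (an incoming carry is propagated). Hence
  \<open>e (t + 1) \<equiv> ((a t + b t) choose p) + e t * ((a t + b t) choose (p - 1))\<close>, and
  unrolling this recurrence from \<open>e 0 = 0\<close> gives the formula.\<close>

text \<open>In Vandermonde's sum every term with \<open>0 < k \<le> m < p\<close> has the factor
  \<open>p choose k\<close>, a multiple of \<open>p\<close>; only \<open>k = 0\<close>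
  survives.\<close>

lemma cong_choose_add_prime:
  fixes p s m :: nat
  assumes "prime p" "m < p"
  shows "[(p + s) choose m = s choose m] (mod p)"
proof -
  have "(p + s) choose m = (\<Sum>k\<le>m. (p choose k) * (s choose (m - k)))"
    by (rule vandermonde[symmetric])
  also have "\<dots> = (s choose m) + (\<Sum>k\<in>{..m} - {0}. (p choose k) * (s choose (m - k)))"
    by (subst sum.remove[where x = 0]) auto
  finally have eq: "(p + s) choose m = \<dots>" .
  have "p dvd (\<Sum>k\<in>{..m} - {0}. (p choose k) * (s choose (m - k)))"
    using assms by (intro dvd_sum dvd_mult2 dvd_choose_prime) auto
  thus ?thesis
    unfolding eq by (auto simp: cong_def)
qed

text \<open>Here the surviving Vandermonde term is \<open>k = p\<close>, equal to 1; the term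
  \<open>k = 0\<close> vanishes since \<open>s < p\<close>, and the others are multiples of
  \<open>p\<close>.\<close>

lemma cong_choose_prime_add_prime:
  fixes p s :: nat
  assumes "prime p" "s < p"
  shows "[(p + s) choose p = 1] (mod p)"
proof -
  have "(p + s) choose p = (\<Sum>k\<le>p. (p choose k) * (s choose (p - k)))"
    by (rule vandermonde[symmetric])
  also have "\<dots> = 1 + (\<Sum>k<p. (p choose k) * (s choose (p - k)))"
    by (simp add: lessThan_Suc_atMost[symmetric])
  finally have eq: "(p + s) choose p = \<dots>" .
  have "p dvd (p choose k) * (s choose (p - k))" if "k < p" for k
    using assms that by (cases "k = 0") (auto simp: binomial_eq_0 intro!: dvd_mult2 dvd_choose_prime)
  hence "p dvd (\<Sum>k<p. (p choose k) * (s choose (p - k)))"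
    by (intro dvd_sum) auto
  hence "[1 + (\<Sum>k<p. (p choose k) * (s choose (p - k))) = 1 + 0] (mod p)"
    by (intro cong_add cong_refl) (simp add: cong_0_iff)
  thus ?thesis
    unfolding eq by simp
qed

lemma carry_step_cong:
  fixes p a b e :: nat
  assumes "prime p" "a < p" "b < p" "e \<le> 1"
  shows "[(a + b + e) div p = ((a + b) choose p) + e * ((a + b) choose (p - 1))] (mod p)"
proof -
  have p: "p \<ge> 2" using assms(1) by (rule prime_ge_2_nat)
  consider "a + b < p - 1" | "a + b = p - 1" | "a + b \<ge> p" by linarith
  thus ?thesis
  proof cases
    case 1
    thus ?thesis using assms by (simp add: binomial_eq_0)
  next
    case 2
    have "e = 0 \<or> e = 1" using assms(4) by linarith
    thus ?thesis using 2 p by (auto simp: binomial_eq_0)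
  next
    case 3
    define s where "s = a + b - p"
    \<comment> \<open>Two digits sum to at most \<open>2 * p - 2\<close>. The resulting bound on
      \<open>s\<close> keeps \<open>p + s + e\<close> below \<open>2 * p\<close> and makes
      \<open>s choose (p - 1)\<close> vanish.\<close>
    have s: "a + b = p + s" "s < p - 1" using 3 assms p unfolding s_def by auto
    have "(a + b + e) div p = 1"
      using s assms(4) p by (intro div_nat_eqI) auto
    moreover have "[(a + b) choose (p - 1) = 0] (mod p)"
      using cong_choose_add_prime[OF assms(1), of "p - 1" s] s p by (simp add: binomial_eq_0)
    moreover have "[(a + b) choose p = 1] (mod p)"
      using cong_choose_prime_add_prime[OF assms(1), of s] s by simp
    ultimately have "[((a + b) choose p) + e * ((a + b) choose (p - 1)) =
        (a + b + e) div p + e * 0] (mod p)"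
      by (intro cong_add cong_mult) auto
    thus ?thesis by (simp add: cong_sym_eq)
  qed
qed

text \<open>The end terms \<open>k = 0\<close> and \<open>k = p\<close> of Vandermonde's sum are
  absent because \<open>b choose p\<close> and \<open>a choose p\<close> are 0.\<close>

lemma vandermonde_interior:
  fixes a b p :: nat
  assumes "a < p" "b < p"
  shows "(\<Sum>k=1..p - 1. (a choose k) * (b choose (p - k))) = (a + b) choose p"
  unfolding vandermonde[symmetric] using assms
  by (intro sum.mono_neutral_left) (auto simp: binomial_eq_0 not_le Suc_le_eq)

fun carry :: "nat \<Rightarrow> (nat \<Rightarrow> nat) \<Rightarrow> (nat \<Rightarrow> nat) \<Rightarrow> nat \<Rightarrow> nat" where
  "carry p a b 0 = 0"
| "carry p a b (Suc t) = (a t + b t + carry p a b t) div p"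

lemma carry_le_1:
  assumes "\<And>i. i < t \<Longrightarrow> a i < p" "\<And>i. i < t \<Longrightarrow> b i < p"
  shows "carry p a b t \<le> 1"
  using assms
proof (induction t)
  case (Suc t)
  have "a t < p" "b t < p" "carry p a b t \<le> 1" using Suc by auto
  hence "a t + b t + carry p a b t < 2 * p" by linarith
  hence "carry p a b (Suc t) < 2"
    by (simp add: less_mult_imp_div_less)
  thus ?case by linarith
qed simp

text \<open>Invariant of schoolbook addition: after \<open>n\<close> positions the pending carry has
  weight \<open>p ^ n\<close>.\<close>

lemma sum_digits_carry:
  fixes p :: nat
  shows "(\<Sum>i<n. (a i + b i) * p ^ i) =
    (\<Sum>i<n. ((a i + b i + carry p a b i) mod p) * p ^ i) + carry p a b n * p ^ n"
proof (induction n)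
  case (Suc n)
  define x where "x = a n + b n + carry p a b n"
  have "x * p ^ n = (x mod p + x div p * p) * p ^ n" by simp
  hence "x * p ^ n = x mod p * p ^ n + x div p * p ^ Suc n"
    by (simp only: distrib_right mult.assoc power_Suc)
  with Suc show ?case by (simp add: x_def[symmetric]) (simp add: x_def distrib_right)
qed simp

text \<open>Reduction mod \<open>p\<close> isolates the lowest digit; cancelling it and dividing by
  \<open>p\<close> leaves the same claim for the shifted sequences.\<close>

lemma base_digits_unique:
  fixes p :: nat
  assumes "\<And>i. i < n \<Longrightarrow> c i < p" "\<And>i. i < n \<Longrightarrow> d i < p"
    and "(\<Sum>i<n. c i * p ^ i) = (\<Sum>i<n. d i * p ^ i)" and "t < n"
  shows "c t = d t"
  using assms
proof (induction n arbitrary: c d t)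
  case (Suc n)
  have shift: "(\<Sum>i<Suc n. f i * p ^ i) = f 0 + p * (\<Sum>i<n. f (Suc i) * p ^ i)" for f
    by (simp add: sum.lessThan_Suc_shift sum_distrib_left ac_simps del: sum.lessThan_Suc)
  have p: "c 0 < p" "d 0 < p" using Suc.prems by auto
  have eq: "c 0 + p * (\<Sum>i<n. c (Suc i) * p ^ i) = d 0 + p * (\<Sum>i<n. d (Suc i) * p ^ i)"
    using Suc.prems(3) unfolding shift .
  have zero: "c 0 = d 0"
    using arg_cong[OF eq, of "\<lambda>x. x mod p"] p by simp
  have tail: "(\<Sum>i<n. c (Suc i) * p ^ i) = (\<Sum>i<n. d (Suc i) * p ^ i)"
    using eq zero p by simp
  show ?case
  proof (cases t)
    case (Suc u)
    thus ?thesis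
      using Suc.IH[of "\<lambda>i. c (Suc i)" "\<lambda>i. d (Suc i)" u] Suc.prems tail by simp
  qed (simp add: zero)
qed simp

lemma carry_cong_sum:
  fixes p :: nat
  assumes "prime p" "\<And>i. i \<le> s \<Longrightarrow> a i < p" "\<And>i. i \<le> s \<Longrightarrow> b i < p"
  shows "[carry p a b (Suc s) =
    (\<Sum>i=0..s. ((a i + b i) choose p) * (\<Prod>j=i + 1..s. (a j + b j) choose (p - 1)))] (mod p)"
  using assms(2,3)
proof (induction s)
  case 0
  thus ?case using carry_step_cong[OF assms(1), of "a 0" "b 0" 0] by simp
next
  case (Suc s)
  let ?g = "\<lambda>i. (a i + b i) choose p"
  let ?h = "\<lambda>j. (a j + b j) choose (p - 1)"
  let ?S = "\<lambda>s. \<Sum>i=0..s. ?g i * (\<Prod>j=i + 1..s. ?h j)"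
  \<comment> \<open>The new term \<open>i = Suc s\<close> has an empty product; every older product
    gains the factor \<open>?h (Suc s)\<close>.\<close>
  have S: "?S (Suc s) = ?g (Suc s) + ?S s * ?h (Suc s)"
    by (simp add: sum_distrib_right mult.assoc)
  have "carry p a b (Suc s) \<le> 1"
    using Suc.prems by (intro carry_le_1) auto
  hence "[carry p a b (Suc (Suc s)) = ?g (Suc s) + carry p a b (Suc s) * ?h (Suc s)] (mod p)"
    using carry_step_cong[OF assms(1), of "a (Suc s)" "b (Suc s)" "carry p a b (Suc s)"]
      Suc.prems by simp
  also have "[?g (Suc s) + carry p a b (Suc s) * ?h (Suc s) =
      ?g (Suc s) + ?S s * ?h (Suc s)] (mod p)"
    using Suc by (intro cong_add cong_mult cong_refl) auto
  finally show ?case unfolding S .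
qed

theorem theorem2p1:
  fixes p r A B :: nat and a b c :: "nat \<Rightarrow> nat"
  assumes "prime p" and "r \<ge> 1"
    and "\<forall>i\<le>r. a i \<in> {0..p - 1}" and "\<forall>i\<le>r. b i \<in> {0..p - 1}"
    and "A = (\<Sum>i=0..r. a i * p ^ i)" and "B = (\<Sum>i=0..r. b i * p ^ i)"
    and "\<forall>i\<le>r + 1. c i \<in> {0..p - 1}"
    and "A + B = (\<Sum>i=0..r + 1. c i * p ^ i)"
    and "a (r + 1) = 0" and "b (r + 1) = 0"
  shows "[c 0 = a 0 + b 0] (mod p) \<and>
    (\<forall>t\<in>{1..r + 1}.
      [c t = a t + b t +
        (\<Sum>i=0..t - 1. (\<Sum>k=1..p - 1. (a i choose k) * (b i choose (p - k))) *
           (\<Prod>j=i + 1..t - 1. (a j + b j) choose (p - 1)))] (mod p))"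
proof -
  have p: "p \<ge> 2" using assms(1) by (rule prime_ge_2_nat)
  have less_p: "x < p" if "x \<in> {0..p - 1}" for x using that p by auto
  have a: "a i < p" and b: "b i < p" if "i \<le> r + 1" for i
    using that assms(3,4,9,10) p less_p by (cases "i = r + 1"; force)+
  have c: "c i < p" if "i \<le> r + 1" for i
    using that assms(7) less_p by blast
  let ?e = "carry p a b"
  have "?e (r + 1) \<le> 1"
    using a b by (intro carry_le_1) auto
  \<comment> \<open>Both digits at position \<open>r + 1\<close> are 0, so this carry is
    \<open>?e (r + 1) div p\<close> with \<open>?e (r + 1) \<le> 1 < p\<close>. Hence
    \<open>r + 2\<close> digits hold all of \<open>A + B\<close>.\<close>
  hence top: "?e (r + 2) = 0"
    using assms(9,10) p by simp
  have "(\<Sum>i<r + 2. c i * p ^ i) = A + B"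
    unfolding assms(8) by (intro sum.cong) auto
  also have "\<dots> = (\<Sum>i<r + 2. (a i + b i) * p ^ i)"
    using assms(9,10)
    by (simp add: assms(5,6) atLeast0AtMost lessThan_Suc_atMost[symmetric] sum.distrib distrib_right)
  also have "\<dots> = (\<Sum>i<r + 2. ((a i + b i + ?e i) mod p) * p ^ i)"
    unfolding sum_digits_carry[of a b p "r + 2"] top by simp
  finally have digits: "(\<Sum>i<r + 2. c i * p ^ i) = \<dots>" .
  \<comment> \<open>Schoolbook addition and \<open>c\<close> give two base \<open>p\<close>
    expansions of \<open>A + B\<close> of equal length, so their digits agree.\<close>
  have "c t = (a t + b t + ?e t) mod p" if "t \<le> r + 1" for t
    using that c p by (intro base_digits_unique[OF _ _ digits]) auto
  hence ct: "[c t = a t + b t + ?e t] (mod p)" if "t \<le> r + 1" for t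
    using that by (simp add: cong_def)
  show ?thesis
  proof (intro conjI ballI)
    show "[c 0 = a 0 + b 0] (mod p)" using ct[of 0] by simp
  next
    fix t assume t: "t \<in> {1..r + 1}"
    \<comment> \<open>The carry into position \<open>t\<close> depends only on the positions up to
      \<open>s\<close>; writing \<open>t = Suc s\<close> matches
      \<open>carry_cong_sum\<close>.\<close>
    define s where "s = t - 1"
    have ts: "t = Suc s" "s \<le> r" using t by (auto simp: s_def)
    have "(\<Sum>i=0..s. (\<Sum>k=1..p - 1. (a i choose k) * (b i choose (p - k))) *
           (\<Prod>j=i + 1..s. (a j + b j) choose (p - 1))) =
        (\<Sum>i=0..s. ((a i + b i) choose p) * (\<Prod>j=i + 1..s. (a j + b j) choose (p - 1)))"
      using a b ts by (intro sum.cong arg_cong2[where f = "(*)"] vandermonde_interior) auto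
    moreover have "[?e t =
        (\<Sum>i=0..s. ((a i + b i) choose p) * (\<Prod>j=i + 1..s. (a j + b j) choose (p - 1)))] (mod p)"
      unfolding ts using a b ts by (intro carry_cong_sum assms(1)) auto
    ultimately show "[c t = a t + b t +
        (\<Sum>i=0..t - 1. (\<Sum>k=1..p - 1. (a i choose k) * (b i choose (p - k))) *
           (\<Prod>j=i + 1..t - 1. (a j + b j) choose (p - 1)))] (mod p)"
      unfolding s_def[symmetric] using t cong_trans[OF ct cong_add[OF cong_refl]] by simp
  qed
qed

end
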